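(* Let $1\le p<\infty$, $q\in\mathbb{N}$, $q\ge 1$, let $X$ be the homogeneous tree of degree $q+1$, and let $u$ be a weight on $X$. For $R>0$ write $W_{*,R}(f):=\sup_{0<t<R}|W_t(f)|$. The following assertions are equivalent: (a) There exist $R>0$ and a weight $v$ on $X$ such that the operator $W_{*,R}$ is bounded from $l^{p}(X,\mu,u)$ into $l^{p}(X,\mu,v)$. (b) There exist $R>0$ and a weight $v$ on $X$ such that the operator $W_{*,R}$ is bounded from $l^{p}(X,\mu,u)$ into $l^{p,\infty}(X,\mu,v)$. (c) For a certain $R_1>0$, the limit $\lim_{t\to R_1}W_t(f)(x)$ exists for every $f\in l^{p}(X,\mu,u)$ and every $x\in X$. (d) For a certain $R_1>0$, for every $f\in l^{p}(X,\mu,u)$ there exists $x\in X$ for which the limit $\lim_{t\to R_1}W_t(f)(x)$ exists. (e) There exists $R>0$ such that $W_{*,R}(f)(x)<\infty$ for every $x\in X$ and every $f\in l^{p}(X,\mu,u)$. (f) There exists $R>0$ such that $W_{R}(f)(x)<\infty$ for every $x\in X$ and every $f\in l^{p}(X,\mu,u)$. (g) There exists $R>0$ such that, for every $x\in X$: when $1<p<\infty$, $\sum_{y\in X}u(y)^{-p'/p}H_R(d(x,y))^{p'}<\infty$; and when $p=1$, $\sup_{y\in X}H_R(d(x,y))u(y)^{-1}<\infty$. Moreover, each of the conditions (a)–(g) implies that for every $f\in l^{p}(X,\mu,u)$ and every $x\in X$, $\lim_{t\to0^+}W_t(f)(x)=f(x)$.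
   Context: $X$ denotes (the vertex set of) the homogeneous tree of degree $q+1$: the connected graph without cycles in which every vertex has exactly $q+1$ neighbours; for $q=1$, $X=\mathbb{Z}$. $d$ is the graph distance and $\mu$ the counting measure on $X$. The number $p'$ is the conjugate exponent of $p$, $1/p+1/p'=1$. The Laplacian is $\mathcal{L}f(x)=f(x)-\frac{1}{q+1}\sum_{y\in X,\,d(x,y)=1}f(y)$, a bounded operator on $L^p(X,\mu)$ for $1\le p\le\infty$, selfadjoint on $L^2(X,\mu)$. The heat semigroup is $W_t=e^{-t\mathcal{L}}$, $t\ge 0$; its kernel depends only on the distance, i.e. $W_t(f)(x)=\sum_{y\in X}H_t(d(x,y))f(y)$ for a function $H_t:\mathbb{N}\to(0,\infty)$, $t>0$, where $\mathbb{N}=\{0,1,2,\dots\}$ in this context. A weight on $X$ is a function $w:X\to(0,\infty)$. $l^p(X,\mu,w)$ is the space of functions $f:X\to\mathbb{C}$ with $\|f\|^p=\sum_{x\in X}|f(x)|^pw(x)<\infty$, and $l^{p,\infty}(X,\mu,w)$ is the corresponding weak space, with quasi-norm $\sup_{\lambda>0}\lambda\left(\sum_{x:\,|f(x)|>\lambda}w(x)\right)^{1/p}$. Convention: for $f\in l^p(X,\mu,u)$, $W_t(f)(x)$ is given by the series $\sum_{y\in X}H_t(d(x,y))f(y)$. The assertion $W_R(f)(x)<\infty$ means that the series $\sum_{y\in X}H_R(d(x,y))f(y)$ converges absolutely; assertions about $W_{*,R}(f)$ (boundedness or finiteness) include that the series for $W_t(f)(x)$ converges absolutely for all $0<t<R$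 and the relevant $x\in X$; assertions about a limit as $t\to R_1$ (or $t\to 0^+$) mean that the limit exists as a finite number and include that the series for $W_t(f)(x)$ converges absolutely for all $t\neq R_1$ sufficiently close to $R_1$ (respectively all sufficiently small $t>0$). *)

theory Defs
  imports "HOL-Analysis.Analysis"
begin

text \<open>The vertex set is a whole type and the graph is given by its adjacency relation.\<close>

definition graph_cycle :: "('a \<Rightarrow> 'a \<Rightarrow> bool) \<Rightarrow> 'a list \<Rightarrow> bool" where
  "graph_cycle adj xs \<longleftrightarrow> length xs \<ge> 3 \<and> distinct xs \<and>
     (\<forall>i<length xs. adj (xs ! i) (xs ! (Suc i mod length xs)))"

text \<open>Since the cardinality of an infinite set is 0, the degree condition includes local
  finiteness.\<close>

definition homogeneous_tree :: "nat \<Rightarrow> ('a \<Rightarrow> 'a \<Rightarrow> bool) \<Rightarrow> bool" where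
  "homogeneous_tree q adj \<longleftrightarrow>
     (\<forall>x. \<not> adj x x) \<and> (\<forall>x y. adj x y \<longrightarrow> adj y x) \<and>
     (\<forall>x y. adj\<^sup>*\<^sup>* x y) \<and>
     (\<nexists>xs. graph_cycle adj xs) \<and>
     (\<forall>x. card {y. adj x y} = q + 1)"

definition gdist :: "('a \<Rightarrow> 'a \<Rightarrow> bool) \<Rightarrow> 'a \<Rightarrow> 'a \<Rightarrow> nat" where
  "gdist adj x y = (LEAST n. (adj ^^ n) x y)"

definition laplacian :: "nat \<Rightarrow> ('a \<Rightarrow> 'a \<Rightarrow> bool) \<Rightarrow> ('a \<Rightarrow> complex) \<Rightarrow> 'a \<Rightarrow> complex" where
  "laplacian q adj f x = f x - (1 / of_nat (q + 1)) * (\<Sum>y | gdist adj x y = 1. f y)"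

text \<open>The exponential series of the bounded operator \<open>- t L\<close>, evaluated at a point. For functions
  in the unweighted Lebesgue spaces it converges in norm, hence pointwise.\<close>

definition exp_laplacian ::
    "nat \<Rightarrow> ('a \<Rightarrow> 'a \<Rightarrow> bool) \<Rightarrow> real \<Rightarrow> ('a \<Rightarrow> complex) \<Rightarrow> 'a \<Rightarrow> complex" where
  "exp_laplacian q adj t f x = (\<Sum>n. ((- t) ^ n / fact n) *\<^sub>R (laplacian q adj ^^ n) f x)"

text \<open>The radial kernel: the matrix entry of \<open>e\<^sup>-\<^sup>t\<^sup>L\<close> at \<open>(x, y)\<close> is its value at \<open>x\<close> on the unit mass
  at \<open>y\<close>, and on a homogeneous tree it is real and depends only on the distance. All distances
  occur when \<open>q \<ge> 1\<close>, so the function is uniquely determined.\<close>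

definition heat_kernel :: "nat \<Rightarrow> ('a \<Rightarrow> 'a \<Rightarrow> bool) \<Rightarrow> real \<Rightarrow> nat \<Rightarrow> real" where
  "heat_kernel q adj t =
     (THE h. \<forall>x y. exp_laplacian q adj t (indicator {y}) x = complex_of_real (h (gdist adj x y)))"

text \<open>On weighted spaces the semigroup is defined by the kernel series; \<open>heat_converges\<close> says that
  the series converges absolutely.\<close>

definition heat :: "nat \<Rightarrow> ('a \<Rightarrow> 'a \<Rightarrow> bool) \<Rightarrow> real \<Rightarrow> ('a \<Rightarrow> complex) \<Rightarrow> 'a \<Rightarrow> complex" where
  "heat q adj t f x = (\<Sum>\<^sub>\<infinity>y. complex_of_real (heat_kernel q adj t (gdist adj x y)) * f y)"

definition heat_converges ::
    "nat \<Rightarrow> ('a \<Rightarrow> 'a \<Rightarrow> bool) \<Rightarrow> real \<Rightarrow> ('a \<Rightarrow> complex) \<Rightarrow> 'a \<Rightarrow> bool" where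
  "heat_converges q adj t f x \<longleftrightarrow>
     (\<lambda>y. norm (complex_of_real (heat_kernel q adj t (gdist adj x y)) * f y)) summable_on UNIV"

text \<open>The real-valued supremum below is meaningful only where \<open>heat_max_finite\<close> holds.\<close>

definition heat_max :: "nat \<Rightarrow> ('a \<Rightarrow> 'a \<Rightarrow> bool) \<Rightarrow> real \<Rightarrow> ('a \<Rightarrow> complex) \<Rightarrow> 'a \<Rightarrow> real" where
  "heat_max q adj R f x = (SUP t\<in>{0<..<R}. norm (heat q adj t f x))"

definition heat_max_finite ::
    "nat \<Rightarrow> ('a \<Rightarrow> 'a \<Rightarrow> bool) \<Rightarrow> real \<Rightarrow> ('a \<Rightarrow> complex) \<Rightarrow> 'a \<Rightarrow> bool" where
  "heat_max_finite q adj R f x \<longleftrightarrow>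
     (\<forall>t\<in>{0<..<R}. heat_converges q adj t f x) \<and>
     bdd_above ((\<lambda>t. norm (heat q adj t f x)) ` {0<..<R})"

definition weight :: "('a \<Rightarrow> real) \<Rightarrow> bool" where
  "weight w \<longleftrightarrow> (\<forall>x. w x > 0)"

definition lp :: "real \<Rightarrow> ('a \<Rightarrow> real) \<Rightarrow> ('a \<Rightarrow> 'b::real_normed_vector) set" where
  "lp p w = {f. (\<lambda>x. norm (f x) powr p * w x) summable_on UNIV}"

definition lp_norm :: "real \<Rightarrow> ('a \<Rightarrow> real) \<Rightarrow> ('a \<Rightarrow> 'b::real_normed_vector) \<Rightarrow> real" where
  "lp_norm p w f = (\<Sum>\<^sub>\<infinity>x. norm (f x) powr p * w x) powr (1 / p)"

definition weak_lp :: "real \<Rightarrow> ('a \<Rightarrow> real) \<Rightarrow> ('a \<Rightarrow> 'b::real_normed_vector) set" where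
  "weak_lp p w = {f. (\<forall>s>0. w summable_on {x. norm (f x) > s}) \<and>
     bdd_above ((\<lambda>s. s * infsum w {x. norm (f x) > s} powr (1 / p)) ` {0<..})}"

definition weak_lp_norm :: "real \<Rightarrow> ('a \<Rightarrow> real) \<Rightarrow> ('a \<Rightarrow> 'b::real_normed_vector) \<Rightarrow> real" where
  "weak_lp_norm p w f = (SUP s\<in>{0<..}. s * infsum w {x. norm (f x) > s} powr (1 / p))"

text \<open>Only meaningful for \<open>p > 1\<close>.\<close>

definition conj_exponent :: "real \<Rightarrow> real" where
  "conj_exponent p = p / (p - 1)"

definition heat_max_bounded_strong ::
    "nat \<Rightarrow> ('a \<Rightarrow> 'a \<Rightarrow> bool) \<Rightarrow> real \<Rightarrow> real \<Rightarrow> ('a \<Rightarrow> real) \<Rightarrow> ('a \<Rightarrow> real) \<Rightarrow> bool" where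
  "heat_max_bounded_strong q adj R p u v \<longleftrightarrow>
     (\<exists>C. \<forall>f\<in>lp p u. (\<forall>x. heat_max_finite q adj R f x) \<and> heat_max q adj R f \<in> lp p v \<and>
        lp_norm p v (heat_max q adj R f) \<le> C * lp_norm p u f)"

definition heat_max_bounded_weak ::
    "nat \<Rightarrow> ('a \<Rightarrow> 'a \<Rightarrow> bool) \<Rightarrow> real \<Rightarrow> real \<Rightarrow> ('a \<Rightarrow> real) \<Rightarrow> ('a \<Rightarrow> real) \<Rightarrow> bool" where
  "heat_max_bounded_weak q adj R p u v \<longleftrightarrow>
     (\<exists>C. \<forall>f\<in>lp p u. (\<forall>x. heat_max_finite q adj R f x) \<and> heat_max q adj R f \<in> weak_lp p v \<and>
        weak_lp_norm p v (heat_max q adj R f) \<le> C * lp_norm p u f)"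

text \<open>For a filter on times, the existence of a limit includes absolute convergence of the series
  for all times eventually in the filter.\<close>

definition heat_tendsto ::
    "nat \<Rightarrow> ('a \<Rightarrow> 'a \<Rightarrow> bool) \<Rightarrow> ('a \<Rightarrow> complex) \<Rightarrow> 'a \<Rightarrow> complex \<Rightarrow> real filter \<Rightarrow> bool" where
  "heat_tendsto q adj f x l F \<longleftrightarrow>
     (\<forall>\<^sub>F t in F. heat_converges q adj t f x) \<and> ((\<lambda>t. heat q adj t f x) \<longlongrightarrow> l) F"

end

theory Submission
  imports Defs
begin

text \<open>The heat kernel is \<open>K\<^sub>t(x, y) = e\<^sup>-\<^sup>t \<Sum>\<^sub>n t\<^sup>n p\<^sub>n(x, y) / n!\<close>, where \<open>p\<^sub>n\<close> are the transition
  probabilities of the simple random walk; they are radial because every vertex \<open>x \<noteq> y\<close> has exactly one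
  neighbour nearer to \<open>y\<close>. Nonnegativity of the coefficients gives \<open>K\<^sub>s \<le> e\<^sup>t K\<^sub>t\<close> for \<open>s \<le> t\<close>, and
  \<open>p\<^sub>n(z, y) \<le> (q + 1) p\<^sub>n\<^sub>+\<^sub>1(x, y)\<close> for neighbours \<open>x, z\<close> gives \<open>K\<^sub>s(z, \<cdot>) \<le> C K\<^sub>t(x, \<cdot>)\<close> for
  \<open>s < t\<close> and arbitrary vertices. So convergence of the series at one time and one vertex forces
  convergence at all smaller times and all vertices, with a common summable majorant, whence the
  limits. Convergence for all \<open>f\<close> is a duality condition on the kernel, and by uniform boundedness
  it bounds the maximal operator at \<open>x\<close> by \<open>M(x) \<parallel>f\<parallel>\<close>; a weight \<open>v\<close> with \<open>\<Sum>\<^sub>x M(x)\<^sup>p v(x) < \<infinity>\<close>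
  exists because the tree is countable.\<close>

section \<open>Paths and distances in the tree\<close>

text \<open>Walks that never go straight back along the edge just used. In a tree these turn out to
  be the geodesics, so distance becomes list length. The empty list is excluded so that every path
  has a first vertex.\<close>

fun nonbacktracking :: "('a \<Rightarrow> 'a \<Rightarrow> bool) \<Rightarrow> 'a list \<Rightarrow> bool" where
  "nonbacktracking adj [] = False"
| "nonbacktracking adj [x] = True"
| "nonbacktracking adj [x, y] = adj x y"
| "nonbacktracking adj (x # y # z # xs) = (adj x y \<and> x \<noteq> z \<and> nonbacktracking adj (y # z # xs))"

lemma nonbacktracking_Cons_iff:
  "nonbacktracking adj (x # y # ys) \<longleftrightarrow>
     adj x y \<and> (ys \<noteq> [] \<longrightarrow> x \<noteq> hd ys) \<and> nonbacktracking adj (y # ys)"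
  by (cases ys) auto

lemma nonbacktracking_adj:
  "nonbacktracking adj xs \<Longrightarrow> Suc i < length xs \<Longrightarrow> adj (xs ! i) (xs ! Suc i)"
proof (induction adj xs arbitrary: i rule: nonbacktracking.induct)
  case (4 adj x y z xs)
  then show ?case by (cases i) auto
qed auto

text \<open>If the head \<open>x\<close> recurred at index \<open>j\<close> of the tail, the
  vertices from \<open>x\<close> up to just before its return would form a cycle. Its length
  \<open>j + 1\<close> is at least 3, because \<open>j = 0\<close> would be a loop and
  \<open>j = 1\<close> a step straight back.\<close>

lemma nonbacktracking_distinct:
  assumes irrefl: "\<And>x. \<not> adj x x" and acyclic: "\<nexists>xs. graph_cycle adj xs"
  shows "nonbacktracking adj xs \<Longrightarrow> distinct xs"
proof (induction xs)
  case (Cons x ys)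
  show ?case
  proof (cases ys)
    case (Cons y zs)
    have nb: "nonbacktracking adj ys"
      using Cons.prems Cons by (simp add: nonbacktracking_Cons_iff)
    then have dist: "distinct ys"
      by (rule Cons.IH)
    have "x \<notin> set ys"
    proof
      assume "x \<in> set ys"
      then obtain j where j: "j < length ys" "ys ! j = x"
        by (auto simp: in_set_conv_nth)
      have "j \<noteq> 0"
        using Cons.prems Cons j irrefl by (cases j) (auto simp: nonbacktracking_Cons_iff)
      moreover have "j \<noteq> 1"
        using Cons.prems Cons j by (cases zs) (auto simp: nonbacktracking_Cons_iff)
      ultimately have "j \<ge> 2" by simp
      have "x \<notin> set (take j ys)"
        using dist j by (auto simp: in_set_conv_nth nth_eq_iff_index_eq)
      then have "distinct (x # take j ys)"
        using dist by simp
      moreover have "adj ((x # take j ys) ! i) ((x # take j ys) ! (Suc i mod length (x # take j ys)))"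
        if "i < length (x # take j ys)" for i
      proof -
        have len: "length (x # take j ys) = Suc j" using j by simp
        have step: "adj ((x # ys) ! i) ((x # ys) ! Suc i)"
          using nonbacktracking_adj[OF Cons.prems, of i] that j by simp
        have eq1: "(x # take j ys) ! i = (x # ys) ! i"
          using that len by (cases i) auto
        \<comment> \<open>For \<open>i = j\<close> the successor index wraps around to
          \<open>x\<close>, which is also \<open>ys ! j\<close>, so the closing edge is again an
          edge of the walk.\<close>
        show ?thesis
        proof (cases "i = j")
          case True
          then show ?thesis using step eq1 j len by simp
        next
          case False
          then have "i < j" using that len by simp
          then show ?thesis using step eq1 j len by simp
        qed
      qed
      ultimately have "graph_cycle adj (x # take j ys)"
        using \<open>j \<ge> 2\<close> j unfolding graph_cycle_def by auto
      then show False using acyclic by blast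
    qed
    then show ?thesis using dist by simp
  qed simp
qed simp

text \<open>Two paths that leave \<open>a\<close> by different first steps join at \<open>a\<close>
  without backtracking. The induction carries the vertices of \<open>xs\<close> across the junction
  one at a time.\<close>

lemma nonbacktracking_rev_append:
  assumes sym: "\<And>x y. adj x y \<Longrightarrow> adj y x"
  shows "nonbacktracking adj (a # xs) \<Longrightarrow> nonbacktracking adj (a # ys) \<Longrightarrow>
    (xs \<noteq> [] \<Longrightarrow> ys \<noteq> [] \<Longrightarrow> hd xs \<noteq> hd ys) \<Longrightarrow> nonbacktracking adj (rev xs @ a # ys)"
proof (induction xs arbitrary: a ys)
  case (Cons b xs)
  have "nonbacktracking adj (rev xs @ b # (a # ys))"
  proof (rule Cons.IH)
    show "nonbacktracking adj (b # xs)"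
      using Cons.prems(1) by (simp add: nonbacktracking_Cons_iff)
    show "nonbacktracking adj (b # a # ys)"
      using Cons.prems sym by (auto simp: nonbacktracking_Cons_iff)
    show "hd xs \<noteq> hd (a # ys)" if "xs \<noteq> []"
      using Cons.prems(1) that by (auto simp: nonbacktracking_Cons_iff)
  qed
  then show ?case by simp
qed simp

section \<open>Geodesics, distances and radial sums in a homogeneous tree\<close>

locale tree =
  fixes adj :: "'a \<Rightarrow> 'a \<Rightarrow> bool" and q :: nat
  assumes tree: "homogeneous_tree q adj" and degree: "q \<ge> 1"
begin

lemma irrefl: "\<not> adj x x"
  and sym: "adj x y \<Longrightarrow> adj y x"
  and connected: "adj\<^sup>*\<^sup>* x y"
  and acyclic: "\<nexists>xs. graph_cycle adj xs"
  and card_nbrs: "card {y. adj x y} = q + 1"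
  using tree unfolding homogeneous_tree_def by blast+

lemma finite_nbrs: "finite {y. adj x y}"
  using card_nbrs[of x] by (metis Suc_eq_plus1 card.infinite nat.distinct(1))

text \<open>Common first steps are stripped off. Where the paths part, one reversed and followed by
  the other would be a nonbacktracking path that visits the common endpoint twice, against
  distinctness.\<close>

lemma nonbacktracking_unique:
  "nonbacktracking adj (a # xs) \<Longrightarrow> nonbacktracking adj (a # ys) \<Longrightarrow>
    last (a # xs) = last (a # ys) \<Longrightarrow> xs = ys"
proof (induction xs arbitrary: a ys)
  case Nil
  then have "distinct (a # ys)"
    using nonbacktracking_distinct[OF irrefl acyclic] by blast
  then show ?case
    using Nil.prems(3) by (cases ys) (auto split: if_splits)
next
  case (Cons b xs)
  have dist: "distinct (a # b # xs)"
    using Cons.prems(1) nonbacktracking_distinct[OF irrefl acyclic] by blast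
  show ?case
  proof (cases ys)
    case Nil
    then show ?thesis
      using dist Cons.prems(3) last_in_set[of "b # xs"] by (auto split: if_splits)
  next
    case (Cons c zs)
    show ?thesis
    proof (cases "b = c")
      case True
      then show ?thesis
        using Cons.IH[of b zs] Cons.prems Cons by (simp add: nonbacktracking_Cons_iff)
    next
      case False
      have "nonbacktracking adj (rev (b # xs) @ a # ys)"
        by (rule nonbacktracking_rev_append[OF sym]) (use Cons.prems(1,2) False Cons in auto)
      then have "distinct (rev (b # xs) @ a # ys)"
        using nonbacktracking_distinct[OF irrefl acyclic] by blast
      moreover have "last (b # xs) \<in> set (rev (b # xs))"
        unfolding set_rev by (rule last_in_set) simp
      moreover have "last (b # xs) \<in> set (a # ys)"
        using Cons.prems(3) Cons by auto
      ultimately show ?thesis unfolding distinct_append by blast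
    qed
  qed
qed

text \<open>Prepending an edge to a reduced walk either leaves it reduced or cancels against its
  first edge, so reduction never lengthens a walk.\<close>

lemma relpowp_imp_nonbacktracking:
  "(adj ^^ n) x y \<Longrightarrow> \<exists>xs. nonbacktracking adj (x # xs) \<and> last (x # xs) = y \<and> length xs \<le> n"
proof (induction n arbitrary: x)
  case 0
  then show ?case by (intro exI[of _ "[]"]) auto
next
  case (Suc n)
  then obtain z where z: "adj x z" "(adj ^^ n) z y"
    by (metis relpowp_Suc_E2)
  then obtain zs where zs: "nonbacktracking adj (z # zs)" "last (z # zs) = y" "length zs \<le> n"
    using Suc.IH by blast
  show ?case
  proof (cases "zs \<noteq> [] \<and> hd zs = x")
    case True
    then obtain ws where "zs = x # ws" by (cases zs) auto
    then show ?thesis using zs by (intro exI[of _ ws]) (auto simp: nonbacktracking_Cons_iff)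
  next
    case False
    then show ?thesis using zs z by (intro exI[of _ "z # zs"]) (auto simp: nonbacktracking_Cons_iff)
  qed
qed

lemma nonbacktracking_imp_relpowp:
  "nonbacktracking adj (x # xs) \<Longrightarrow> (adj ^^ length xs) x (last (x # xs))"
proof (induction xs arbitrary: x)
  case (Cons y xs)
  then show ?case
    by (auto simp: nonbacktracking_Cons_iff simp del: relpowp.simps intro: relpowp_Suc_I2)
qed simp

lemma nonbacktracking_exists:
  obtains xs where "nonbacktracking adj (x # xs)" "last (x # xs) = y"
  using relpowp_imp_nonbacktracking connected[of x y] by (metis rtranclp_imp_relpowp)

text \<open>Every walk between the endpoints reduces to a nonbacktracking path that is no longer,
  and by uniqueness that path is \<open>x # xs\<close>.\<close>

lemma gdist_nonbacktracking:
  assumes "nonbacktracking adj (x # xs)"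
  shows "gdist adj x (last (x # xs)) = length xs"
  unfolding gdist_def
proof (rule Least_equality)
  show "(adj ^^ length xs) x (last (x # xs))"
    by (rule nonbacktracking_imp_relpowp[OF assms])
  fix n assume "(adj ^^ n) x (last (x # xs))"
  then show "length xs \<le> n"
    using relpowp_imp_nonbacktracking nonbacktracking_unique[OF assms] by metis
qed

lemma gdist_eq_1_iff: "gdist adj x y = 1 \<longleftrightarrow> adj x y"
proof
  assume "adj x y"
  then show "gdist adj x y = 1"
    using gdist_nonbacktracking[of x "[y]"] by simp
next
  assume *: "gdist adj x y = 1"
  obtain xs where xs: "nonbacktracking adj (x # xs)" "last (x # xs) = y"
    by (rule nonbacktracking_exists)
  then have "length xs = 1" using gdist_nonbacktracking[OF xs(1)] * by simp
  then obtain z where "xs = [z]" by (auto simp: length_Suc_conv)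
  then show "adj x y" using xs by simp
qed

lemma gdist_eq_0_iff: "gdist adj x y = 0 \<longleftrightarrow> x = y"
proof
  assume "x = y"
  then show "gdist adj x y = 0"
    using gdist_nonbacktracking[of x "[]"] by simp
next
  assume *: "gdist adj x y = 0"
  obtain xs where xs: "nonbacktracking adj (x # xs)" "last (x # xs) = y"
    by (rule nonbacktracking_exists)
  then show "x = y" using gdist_nonbacktracking[OF xs(1)] * by simp
qed

text \<open>Every vertex has at least two neighbours, so a nonbacktracking path can always be
  extended at its head. This makes the radial function in \<open>heat_kernel\<close> unique.\<close>

lemma gdist_surj: "\<exists>x y. gdist adj x y = n"
proof -
  have "\<exists>x xs. nonbacktracking adj (x # xs) \<and> length xs = n"
  proof (induction n)
    case 0
    show ?case by (intro exI[of _ undefined] exI[of _ "[]"]) simp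
  next
    case (Suc n)
    then obtain x xs where xs: "nonbacktracking adj (x # xs)" "length xs = n" by blast
    \<comment> \<open>For \<open>xs = []\<close> the value \<open>hd xs\<close> is unspecified;
      avoiding one more vertex does no harm.\<close>
    have "\<not> {z. adj x z} \<subseteq> {hd xs}"
    proof
      assume "{z. adj x z} \<subseteq> {hd xs}"
      then have "card {z. adj x z} \<le> card {hd xs}"
        by (intro card_mono) auto
      then show False using card_nbrs[of x] degree by simp
    qed
    then obtain z where "adj x z" "z \<noteq> hd xs" by auto
    then have "nonbacktracking adj (z # x # xs)"
      using xs sym by (auto simp: nonbacktracking_Cons_iff)
    then show ?case using xs by (intro exI[of _ z] exI[of _ "x # xs"]) simp
  qed
  then show ?thesis using gdist_nonbacktracking by blast
qed

text \<open>For \<open>x \<noteq> y\<close> the second vertex of the path to \<open>y\<close> is one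
  step nearer to \<open>y\<close>; prepending any of the other \<open>q\<close> neighbours extends
  the path, so these are one step farther.\<close>

lemma sum_nbrs_radial:
  fixes g :: "nat \<Rightarrow> real"
  shows "(\<Sum>z | adj x z. g (gdist adj z y)) =
    (if x = y then (q + 1) * g 1 else g (gdist adj x y - 1) + q * g (gdist adj x y + 1))"
proof (cases "x = y")
  case True
  have "(\<Sum>z | adj x z. g (gdist adj z y)) = (\<Sum>z | adj x z. g 1)"
  proof (intro sum.cong refl)
    fix z assume "z \<in> {z. adj x z}"
    then have "gdist adj z y = 1" unfolding gdist_eq_1_iff using True sym by simp
    then show "g (gdist adj z y) = g 1" by simp
  qed
  then show ?thesis using True card_nbrs by simp
next
  case False
  obtain xs where xs: "nonbacktracking adj (x # xs)" "last (x # xs) = y"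
    by (rule nonbacktracking_exists)
  then obtain b bs where bs: "xs = b # bs" using False by (cases xs) auto
  have d: "gdist adj x y = length bs + 1"
    using gdist_nonbacktracking[OF xs(1)] xs bs by simp
  have db: "gdist adj b y = length bs"
    using gdist_nonbacktracking[of b bs] xs bs by (simp add: nonbacktracking_Cons_iff)
  have dz: "gdist adj z y = length bs + 2" if "adj x z" "z \<noteq> b" for z
  proof -
    have "nonbacktracking adj (z # x # xs)"
      using xs bs that sym by (auto simp: nonbacktracking_Cons_iff)
    from gdist_nonbacktracking[OF this] show ?thesis using xs bs by simp
  qed
  have b: "adj x b" using xs bs by (simp add: nonbacktracking_Cons_iff)
  have "(\<Sum>z | adj x z. g (gdist adj z y)) =
      g (gdist adj b y) + (\<Sum>z \<in> {z. adj x z} - {b}. g (gdist adj z y))"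
    using b finite_nbrs by (intro sum.remove) auto
  also have "(\<Sum>z \<in> {z. adj x z} - {b}. g (gdist adj z y)) = (\<Sum>z \<in> {z. adj x z} - {b}. g (length bs + 2))"
    using dz by (intro sum.cong) auto
  also have "\<dots> = q * g (length bs + 2)"
    using b finite_nbrs card_nbrs by simp
  finally show ?thesis using False d db by simp
qed

text \<open>By local finiteness only finitely many vertices end a walk of given length from a fixed
  vertex, and by connectedness these sets exhaust the tree.\<close>

lemma countable_vertices: "countable (UNIV :: 'a set)"
proof -
  have "finite {y. (adj ^^ n) x y}" for n x
  proof (induction n)
    case 0
    have "{y. (adj ^^ 0) x y} = {x}" by auto
    then show ?case by simp
  next
    case (Suc n)
    have "{y. (adj ^^ Suc n) x y} = (\<Union>z\<in>{z. (adj ^^ n) x z}. {y. adj z y})"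
      by auto
    then show ?case using Suc finite_nbrs by simp
  qed
  then have "countable (\<Union>n. {y. (adj ^^ n) undefined y})"
    by (intro countable_UN) (auto intro: countable_finite)
  moreover have "(\<Union>n. {y. (adj ^^ n) undefined y}) = UNIV"
    using connected rtranclp_imp_relpowp by fastforce
  ultimately show ?thesis by simp
qed

end

section \<open>The heat kernel\<close>

text \<open>Pascal's rule in the form needed to pass from the expansion of \<open>(I - P)^n\<close>
  to that of \<open>(I - P)^(n+1)\<close>, with the shift of \<open>g\<close> in the role of
  \<open>P\<close>.\<close>

lemma sum_binomial_alternating_Suc:
  fixes g :: "nat \<Rightarrow> real"
  shows "(\<Sum>k\<le>Suc n. real (Suc n choose k) * (- 1) ^ k * g k) =
    (\<Sum>k\<le>n. real (n choose k) * (- 1) ^ k * g k) - (\<Sum>k\<le>n. real (n choose k) * (- 1) ^ k * g (Suc k))"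
proof -
  \<comment> \<open>The added term vanishes because \<open>n choose Suc n = 0\<close>.\<close>
  have "(\<Sum>k\<le>n. real (n choose k) * (- 1) ^ k * g k) = (\<Sum>k\<le>Suc n. real (n choose k) * (- 1) ^ k * g k)"
    by simp
  also have "\<dots> = g 0 + (\<Sum>k\<le>n. real (n choose Suc k) * (- 1) ^ Suc k * g (Suc k))"
    by (subst sum.atMost_Suc_shift) simp
  finally have *: "(\<Sum>k\<le>n. real (n choose k) * (- 1) ^ k * g k) =
      g 0 + (\<Sum>k\<le>n. real (n choose Suc k) * (- 1) ^ Suc k * g (Suc k))" .
  have "real (Suc n choose Suc k) * (- 1) ^ Suc k * g (Suc k) =
      real (n choose Suc k) * (- 1) ^ Suc k * g (Suc k) - real (n choose k) * (- 1) ^ k * g (Suc k)" for k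
    by (simp add: algebra_simps)
  then show ?thesis
    unfolding * by (subst sum.atMost_Suc_shift) (simp only: sum_subtractf, simp)
qed

section \<open>Transition probabilities of the random walk and the heat kernel\<close>

context tree
begin

text \<open>Matrix entries of the powers of \<open>P\<close>, the averaging over neighbours;
  \<open>laplacian\<close> is the identity minus \<open>P\<close>.\<close>

primrec step_prob :: "nat \<Rightarrow> 'a \<Rightarrow> 'a \<Rightarrow> real" where
  "step_prob 0 x y = (if x = y then 1 else 0)"
| "step_prob (Suc n) x y = (\<Sum>z | adj x z. step_prob n z y) / real (q + 1)"

lemma step_prob_nonneg: "step_prob n x y \<ge> 0"
  by (induction n arbitrary: x) (auto intro!: sum_nonneg divide_nonneg_nonneg)

lemma step_prob_le_1: "step_prob n x y \<le> 1"
proof (induction n arbitrary: x)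
  case (Suc n)
  have "(\<Sum>z | adj x z. step_prob n z y) \<le> (\<Sum>z | adj x z. 1)"
    using Suc by (intro sum_mono) auto
  then show ?case using card_nbrs by simp
qed simp

lemma step_prob_nbr_le:
  assumes "adj x z"
  shows "step_prob n z y \<le> real (q + 1) * step_prob (Suc n) x y"
proof -
  have "step_prob n z y \<le> (\<Sum>z | adj x z. step_prob n z y)"
    using assms finite_nbrs step_prob_nonneg by (intro member_le_sum) auto
  then show ?thesis by simp
qed

text \<open>Averaging over neighbours maps functions of the distance to \<open>y\<close> to
  functions of that distance, by the same formula for all \<open>y\<close>.\<close>

lemma step_prob_radial: "\<exists>w. \<forall>x y. step_prob n x y = w (gdist adj x y)"
proof (induction n)
  case 0
  show ?case
    by (intro exI[of _ "\<lambda>k. if k = 0 then 1 else 0"]) (simp add: gdist_eq_0_iff)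
next
  case (Suc n)
  then obtain w where "\<And>x y. step_prob n x y = w (gdist adj x y)" by blast
  then show ?case
    by (intro exI[of _ "\<lambda>k. (if k = 0 then (q + 1) * w 1 else w (k - 1) + q * w (k + 1)) / real (q + 1)"])
      (simp add: sum_nbrs_radial gdist_eq_0_iff)
qed

text \<open>The binomial expansion of \<open>(I - P)^n\<close>, applied to the unit mass at
  \<open>y\<close>.\<close>

lemma laplacian_power_indicator:
  "(laplacian q adj ^^ n) (indicator {y}) x =
    complex_of_real (\<Sum>k\<le>n. real (n choose k) * (- 1) ^ k * step_prob k x y)"
proof (induction n arbitrary: x)
  case 0
  show ?case by (simp add: indicator_def)
next
  case (Suc n)
  let ?c = "\<lambda>k. real (n choose k) * (- 1) ^ k"
  have "(laplacian q adj ^^ Suc n) (indicator {y}) x =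
      complex_of_real ((\<Sum>k\<le>n. ?c k * step_prob k x y) -
        (\<Sum>z | adj x z. \<Sum>k\<le>n. ?c k * step_prob k z y) / real (q + 1))"
    unfolding funpow.simps o_apply laplacian_def[of q adj "(laplacian q adj ^^ n) _"] gdist_eq_1_iff Suc.IH
    by simp
  also have "(\<Sum>z | adj x z. \<Sum>k\<le>n. ?c k * step_prob k z y) / real (q + 1) =
      (\<Sum>k\<le>n. ?c k * step_prob (Suc k) x y)"
    by (subst sum.swap) (simp add: sum_divide_distrib sum_distrib_left)
  finally show ?case by (simp only: sum_binomial_alternating_Suc)
qed

text \<open>The matrix entries of \<open>e^(-t) e^(tP)\<close>. Splitting off \<open>e^(-t)\<close>
  leaves a power series in \<open>t\<close> with nonnegative coefficients, the source of all the
  comparisons below.\<close>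

definition kernel :: "real \<Rightarrow> 'a \<Rightarrow> 'a \<Rightarrow> real" where
  "kernel t x y = exp (- t) * (\<Sum>n. t ^ n / fact n * step_prob n x y)"

lemma summable_kernel: "summable (\<lambda>n. norm (t ^ n / fact n * step_prob n x y))"
proof (rule summable_comparison_test'[where N = 0])
  show "summable (\<lambda>n. \<bar>t\<bar> ^ n / fact n)"
    using summable_exp[of "\<bar>t\<bar>"] by (simp add: field_simps)
  show "norm (norm (t ^ n / fact n * step_prob n x y)) \<le> \<bar>t\<bar> ^ n / fact n" for n
    using step_prob_le_1[of n x y] step_prob_nonneg[of n x y]
    by (simp add: abs_mult power_abs divide_right_mono mult_left_le)
qed

text \<open>In the Cauchy product of the series for \<open>e^(tP)\<close> and \<open>e^(-t)\<close>,
  the \<open>n\<close>-th term is the binomial expansion of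
  \<open>(-t)^n (I - P)^n / n!\<close>.\<close>

lemma exp_laplacian_indicator:
  "exp_laplacian q adj t (indicator {y}) x = complex_of_real (kernel t x y)"
proof -
  let ?A = "\<lambda>n. t ^ n / fact n * step_prob n x y" and ?B = "\<lambda>n. (- t) ^ n / fact n"
  have "summable (\<lambda>n. norm (?B n))"
    using summable_exp[of "\<bar>t\<bar>"] by (simp add: field_simps power_abs)
  then have "(\<lambda>n. \<Sum>k\<le>n. ?A k * ?B (n - k)) sums ((\<Sum>n. ?A n) * (\<Sum>n. ?B n))"
    by (intro Cauchy_product_sums summable_kernel)
  also have "(\<Sum>n. ?B n) = exp (- t)"
    by (simp add: exp_def field_simps)
  also have "(\<lambda>n. \<Sum>k\<le>n. ?A k * ?B (n - k)) =
      (\<lambda>n. (- t) ^ n / fact n * (\<Sum>k\<le>n. real (n choose k) * (- 1) ^ k * step_prob k x y))"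
  proof (intro ext)
    fix n
    have "?A k * ?B (n - k) =
        (- t) ^ n / fact n * (real (n choose k) * (- 1) ^ k * step_prob k x y)" if "k \<le> n" for k
    proof -
      have "(- t) ^ n * (- 1) ^ k = t ^ k * (- t) ^ (n - k)"
      proof -
        have "(- t) ^ n = (- t) ^ k * (- t) ^ (n - k)"
          using that by (simp flip: power_add)
        then show ?thesis by (simp flip: power_mult_distrib)
      qed
      then show ?thesis
        using that by (simp add: binomial_fact field_simps)
    qed
    then show "(\<Sum>k\<le>n. ?A k * ?B (n - k)) =
        (- t) ^ n / fact n * (\<Sum>k\<le>n. real (n choose k) * (- 1) ^ k * step_prob k x y)"
      by (simp add: sum_distrib_left del: of_nat_Suc)
  qed
  finally have "(\<lambda>n. complex_of_real ((- t) ^ n / fact n *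
      (\<Sum>k\<le>n. real (n choose k) * (- 1) ^ k * step_prob k x y))) sums complex_of_real (kernel t x y)"
    by (subst sums_of_real_iff) (simp add: kernel_def mult.commute)
  then show ?thesis
    unfolding exp_laplacian_def
    by (simp add: laplacian_power_indicator scaleR_conv_of_real sums_iff)
qed

text \<open>The radial profile of \<open>kernel\<close> satisfies the description in
  \<open>heat_kernel\<close>; as every distance occurs, it is the only function that does, so the
  definite description denotes it.\<close>

lemma heat_kernel_gdist: "heat_kernel q adj t (gdist adj x y) = kernel t x y"
proof -
  obtain w where w: "\<And>n x y. step_prob n x y = w n (gdist adj x y)"
    using step_prob_radial by metis
  define h where "h k = exp (- t) * (\<Sum>n. t ^ n / fact n * w n k)" for k
  have h: "kernel t x y = h (gdist adj x y)" for x y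
    by (simp add: kernel_def h_def w)
  have "heat_kernel q adj t = h"
    unfolding heat_kernel_def exp_laplacian_indicator h
  proof (rule the_equality)
    fix g assume "\<forall>x y. complex_of_real (h (gdist adj x y)) = complex_of_real (g (gdist adj x y))"
    then show "g = h"
      using gdist_surj by (metis ext of_real_eq_iff)
  qed simp
  then show ?thesis by (simp add: h)
qed

section \<open>Positivity, continuity and comparison of heat kernels\<close>

lemma kernel_nonneg: "t \<ge> 0 \<Longrightarrow> kernel t x y \<ge> 0"
  unfolding kernel_def
  by (intro mult_nonneg_nonneg suminf_nonneg summable_norm_cancel[OF summable_kernel])
    (auto simp: step_prob_nonneg)

lemma kernel_0: "kernel 0 x y = (if x = y then 1 else 0)"
  using powser_zero[of "\<lambda>n. step_prob n x y / fact n"] by (simp add: kernel_def field_simps)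

lemma continuous_on_kernel: "continuous_on S (\<lambda>t. kernel t x y)"
proof -
  have "summable (\<lambda>n. (step_prob n x y / fact n) * t ^ n)" for t :: real
    using summable_norm_cancel[OF summable_kernel[of t x y]] by (simp add: field_simps)
  then have "isCont (\<lambda>t. \<Sum>n. (step_prob n x y / fact n) * t ^ n) t" for t :: real
    by (rule isCont_powser_converges_everywhere)
  then have "continuous_on S (\<lambda>t. exp (- t) * (\<Sum>n. (step_prob n x y / fact n) * t ^ n))"
    by (intro continuous_intros continuous_at_imp_continuous_on) auto
  then show ?thesis by (simp add: kernel_def field_simps)
qed

lemma kernel_mono_time:
  assumes "0 \<le> s" "s \<le> t"
  shows "kernel s x y \<le> exp t * kernel t x y"
proof -
  have sm: "summable (\<lambda>n. t ^ n / fact n * step_prob n x y)" for t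
    by (rule summable_norm_cancel[OF summable_kernel])
  let ?S = "\<lambda>t. \<Sum>n. t ^ n / fact n * step_prob n x y"
  have nonneg: "0 \<le> ?S s"
    using assms by (intro suminf_nonneg sm) (auto simp: step_prob_nonneg)
  have "kernel s x y \<le> ?S s"
    using assms nonneg by (simp add: kernel_def mult_left_le_one_le)
  also have "\<dots> \<le> ?S t"
    using assms by (intro suminf_le sm mult_right_mono divide_right_mono power_mono)
      (auto simp: step_prob_nonneg)
  also have "\<dots> = exp t * kernel t x y"
    by (simp add: kernel_def exp_minus)
  finally show ?thesis .
qed

text \<open>Moving to a neighbour shifts the index of the series by one. This costs a factor of
  order \<open>n\<close>, which the decay of \<open>(s / t)^n\<close> absorbs since
  \<open>s < t\<close>.\<close>

lemma kernel_nbr_le: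
  assumes "adj x z" "0 < s" "s < t"
  shows "\<exists>C\<ge>0. \<forall>y. kernel s z y \<le> C * kernel t x y"
proof -
  have "(\<lambda>n. real (Suc n) * (s / t) ^ Suc n) \<longlonglongrightarrow> 0"
    using assms by (intro LIMSEQ_Suc powser_times_n_limit_0) auto
  then have "Bseq (\<lambda>n. real (Suc n) * (s / t) ^ Suc n)"
    by (intro convergent_imp_Bseq convergentI)
  then obtain B where B: "B > 0" "\<And>n. norm (real (Suc n) * (s / t) ^ Suc n) \<le> B"
    by (auto elim: BseqE)
  have ratio: "s ^ n / fact n \<le> B / s * (t ^ Suc n / fact (Suc n))" for n
  proof -
    have "real (Suc n) * (s / t) ^ Suc n \<le> B"
      using B(2)[of n] unfolding real_norm_def by (rule order_trans[OF abs_ge_self])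
    then have "real (Suc n) * s ^ Suc n \<le> B * t ^ Suc n"
      using assms by (simp add: power_divide field_simps)
    then show ?thesis
      using assms by (simp add: field_simps del: of_nat_Suc)
  qed
  have sm: "summable (\<lambda>n. t ^ n / fact n * step_prob n x y)" for t x y
    by (rule summable_norm_cancel[OF summable_kernel])
  let ?C = "real (q + 1) * (B / s)"
  have C: "?C \<ge> 0" using B assms by simp
  have "kernel s z y \<le> ?C * exp t * kernel t x y" for y
  proof -
    have smS: "summable (\<lambda>n. t ^ Suc n / fact (Suc n) * step_prob (Suc n) x y)"
      using sm[of t x y] by (subst summable_Suc_iff)
    have nonneg: "0 \<le> (\<Sum>n. s ^ n / fact n * step_prob n z y)"
      using assms by (intro suminf_nonneg sm) (auto simp: step_prob_nonneg)
    have "kernel s z y \<le> (\<Sum>n. s ^ n / fact n * step_prob n z y)"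
      using assms nonneg by (simp add: kernel_def mult_left_le_one_le)
    also have "\<dots> \<le> (\<Sum>n. ?C * (t ^ Suc n / fact (Suc n) * step_prob (Suc n) x y))"
    proof (intro suminf_le sm summable_mult smS)
      fix n
      have "s ^ n / fact n * step_prob n z y \<le>
          (B / s * (t ^ Suc n / fact (Suc n))) * (real (q + 1) * step_prob (Suc n) x y)"
        using assms B by (intro mult_mono ratio step_prob_nbr_le step_prob_nonneg) auto
      then show "s ^ n / fact n * step_prob n z y \<le>
          ?C * (t ^ Suc n / fact (Suc n) * step_prob (Suc n) x y)"
        by (simp only: mult_ac)
    qed
    also have "\<dots> = ?C * (\<Sum>n. t ^ Suc n / fact (Suc n) * step_prob (Suc n) x y)"
      by (rule suminf_mult[OF smS])
    \<comment> \<open>The term with index 0, missing from the shifted series, is nonnegative and is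
      put back.\<close>
    also have "\<dots> \<le> ?C * (\<Sum>n. t ^ n / fact n * step_prob n x y)"
      using step_prob_nonneg[of 0 x y]
      by (intro mult_left_mono C) (subst suminf_split_head[OF sm], simp)
    also have "\<dots> = ?C * exp t * kernel t x y"
      by (simp add: kernel_def exp_minus)
    finally show ?thesis .
  qed
  moreover have "?C * exp t \<ge> 0" by (rule mult_nonneg_nonneg[OF C exp_ge_zero])
  ultimately show ?thesis by blast
qed

text \<open>Induction along a walk from \<open>x\<close> to \<open>z\<close>. Each edge uses up some
  time, so an intermediate time \<open>m\<close> is inserted at every step, with \<open>t\<close>
  fixed and \<open>s\<close> arbitrary.\<close>

lemma kernel_change_vertex:
  assumes "0 < s" "s < t"
  shows "\<exists>C\<ge>0. \<forall>y. kernel s z y \<le> C * kernel t x y"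
  using connected[of x z] assms
proof (induction arbitrary: s rule: rtranclp_induct)
  case base
  then show ?case by (intro exI[of _ "exp t"]) (auto intro: kernel_mono_time)
next
  case (step z z')
  obtain m where m: "s < m" "m < t" using step.prems dense by blast
  obtain C where C: "C \<ge> 0" "\<And>y. kernel s z' y \<le> C * kernel m z y"
    using kernel_nbr_le[OF step.hyps(2), of s m] step.prems m by blast
  obtain C' where C': "C' \<ge> 0" "\<And>y. kernel m z y \<le> C' * kernel t x y"
    using step.IH[of m] step.prems m by auto
  have "kernel s z' y \<le> C * C' * kernel t x y" for y
    using C(2)[of y] mult_left_mono[OF C'(2)[of y] C(1)] by (simp add: mult_ac)
  then show ?case using C C' by (intro exI[of _ "C * C'"]) auto
qed

end

section \<open>Duality in weighted spaces\<close>

lemma lp_iff: "f \<in> lp p u \<longleftrightarrow> (\<lambda>x. norm (f x) powr p * u x) summable_on UNIV"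
  by (simp add: lp_def)

text \<open>A gliding hump without Minkowski's inequality: normalised functions \<open>f\<^sub>k\<close> with large
  integrals against \<open>a\<close> are combined into \<open>(\<Sum>\<^sub>k 2\<^sup>-\<^sup>k |f\<^sub>k|\<^sup>p)\<^sup>1\<^sup>/\<^sup>p\<close>, whose norm is trivially bounded.\<close>

lemma lp_pairing_bounded:
  fixes a u :: "'a \<Rightarrow> real"
  assumes p: "p \<ge> 1" and u: "weight u" and a: "\<And>y. a y \<ge> 0"
    and pair: "\<And>f :: 'a \<Rightarrow> complex. f \<in> lp p u \<Longrightarrow> (\<lambda>y. a y * norm (f y)) summable_on UNIV"
  shows "\<exists>M\<ge>0. \<forall>f :: 'a \<Rightarrow> complex. f \<in> lp p u \<longrightarrow>
    (\<Sum>\<^sub>\<infinity>y. a y * norm (f y)) \<le> M * lp_norm p u f"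
proof (rule ccontr)
  assume "\<not> ?thesis"
  \<comment> \<open>The growth \<open>4 ^ k\<close> is chosen to beat the factor
    \<open>2 ^ k\<close> lost later when \<open>F k\<close> is compared with the combined function
    \<open>g\<close>.\<close>
  then have "\<exists>f :: 'a \<Rightarrow> complex. f \<in> lp p u \<and> (\<Sum>\<^sub>\<infinity>y. a y * norm (f y)) > 4 ^ k * lp_norm p u f"
    for k :: nat
    by (metis linorder_not_le zero_le_numeral zero_le_power)
  then obtain F :: "nat \<Rightarrow> 'a \<Rightarrow> complex" where F: "\<And>k. F k \<in> lp p u"
    "\<And>k. (\<Sum>\<^sub>\<infinity>y. a y * norm (F k y)) > 4 ^ k * lp_norm p u (F k)"
    by metis
  have u0: "u y > 0" for y using u by (simp add: weight_def)
  define I where "I k = (\<Sum>\<^sub>\<infinity>y. norm (F k y) powr p * u y)" for k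
  have I_nonneg: "I k \<ge> 0" for k
    unfolding I_def using u0 by (intro infsum_nonneg mult_nonneg_nonneg) (auto intro: less_imp_le)
  have fin: "(\<Sum>y\<in>S. norm (F k y) powr p * u y) \<le> I k" if "finite S" for S k
    unfolding I_def using F(1)[of k] that
    by (intro finite_sum_le_infsum mult_nonneg_nonneg less_imp_le[OF u0]) (auto simp: lp_iff)
  \<comment> \<open>If \<open>I k = 0\<close>, then \<open>F k\<close> vanishes, and the strict
    inequality defining \<open>F k\<close> would read \<open>0 > 0\<close>.\<close>
  have I_pos: "I k > 0" for k
  proof (rule ccontr)
    assume "\<not> I k > 0"
    then have "I k = 0" using I_nonneg[of k] by simp
    have "F k y = 0" for y
    proof -
      have "norm (F k y) powr p * u y \<le> 0"
        using fin[of "{y}" k] \<open>I k = 0\<close> by simp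
      then have "norm (F k y) powr p \<le> 0"
        using u0[of y] by (simp add: mult_le_0_iff)
      then show ?thesis by simp
    qed
    then have "(\<Sum>\<^sub>\<infinity>y. a y * norm (F k y)) = 0" by simp
    moreover have "lp_norm p u (F k) \<ge> 0" by (simp add: lp_norm_def)
    ultimately show False using F(2)[of k] by (smt (verit) zero_le_mult_iff zero_le_power)
  qed
  define G where "G k y = norm (F k y) powr p / I k" for k y
  have G_nonneg: "G k y \<ge> 0" for k y using I_nonneg by (simp add: G_def)
  have G_sum: "(\<Sum>y\<in>S. G k y * u y) \<le> 1" if "finite S" for S k
  proof -
    have "(\<Sum>y\<in>S. G k y * u y) = (\<Sum>y\<in>S. norm (F k y) powr p * u y) / I k"
      by (simp add: G_def sum_divide_distrib)
    also have "\<dots> \<le> 1" using fin[OF that] I_pos[of k] by simp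
    finally show ?thesis .
  qed
  \<comment> \<open>One-point sets give a bound independent of \<open>k\<close>, so the series
    defining \<open>H\<close> converges at every vertex.\<close>
  have G_le: "G k y \<le> 1 / u y" for k y
    using G_sum[of "{y}" k] u0[of y] by (simp add: field_simps)
  have geom: "summable (\<lambda>k. (1 / 2) ^ k * c)" for c :: real
    by (intro summable_mult2 summable_geometric) simp
  have Gsm: "summable (\<lambda>k. (1 / 2) ^ k * G k y)" for y
  proof (rule summable_comparison_test'[OF geom[of "1 / u y"], of 0])
    show "norm ((1 / 2) ^ k * G k y) \<le> (1 / 2) ^ k * (1 / u y)" for k
      using mult_left_mono[OF G_le[of k y], of "(1 / 2) ^ k"] G_nonneg[of k y] by simp
  qed
  define H where "H y = (\<Sum>k. (1 / 2) ^ k * G k y)" for y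
  have H_ge: "(1 / 2) ^ k * G k y \<le> H y" for k y
    unfolding H_def using sum_le_suminf[OF Gsm[of y], of "{k}"] G_nonneg by simp
  have H_nonneg: "H y \<ge> 0" for y
    unfolding H_def using G_nonneg by (intro suminf_nonneg Gsm) auto
  define g where "g y = complex_of_real (H y powr (1 / p))" for y
  have norm_g: "norm (g y) = H y powr (1 / p)" for y
    by (simp add: g_def)
  have g_lp: "g \<in> lp p u"
    unfolding lp_iff
  proof (rule nonneg_bounded_partial_sums_imp_summable_on)
    show "norm (g y) powr p * u y \<ge> 0" for y
      using u0[of y] by simp
    show "\<forall>\<^sub>F S in finite_subsets_at_top UNIV. (\<Sum>y\<in>S. norm (g y) powr p * u y) \<le> 2"
    proof (rule eventually_finite_subsets_at_top_weakI)
      fix S :: "'a set" assume S: "finite S"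
      have "(\<Sum>y\<in>S. norm (g y) powr p * u y) = (\<Sum>y\<in>S. H y * u y)"
        using H_nonneg p by (intro sum.cong) (auto simp: norm_g powr_powr)
      also have "\<dots> = (\<Sum>y\<in>S. \<Sum>k. (1 / 2) ^ k * G k y * u y)"
        unfolding H_def by (intro sum.cong suminf_mult2 Gsm refl)
      also have "\<dots> = (\<Sum>k. \<Sum>y\<in>S. (1 / 2) ^ k * G k y * u y)"
        by (intro suminf_sum[symmetric] summable_mult2 Gsm)
      also have "\<dots> \<le> (\<Sum>k. (1 / 2) ^ k * 1)"
      proof (rule suminf_le)
        show "(\<Sum>y\<in>S. (1 / 2) ^ k * G k y * u y) \<le> (1 / 2) ^ k * 1" for k
          using mult_left_mono[OF G_sum[OF S, of k], of "(1 / 2) ^ k"]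
          by (simp add: sum_distrib_left mult.assoc)
      qed (intro summable_sum summable_mult2 Gsm geom)+
      also have "\<dots> = 2" using suminf_geometric[of "1 / 2 :: real"] by simp
      finally show "(\<Sum>y\<in>S. norm (g y) powr p * u y) \<le> 2" .
    qed
  qed
  define T where "T = (\<Sum>\<^sub>\<infinity>y. a y * norm (g y))"
  have "2 ^ k \<le> T" for k :: nat
  proof -
    let ?N = "lp_norm p u (F k)"
    have N: "?N = I k powr (1 / p)" "?N > 0"
      using I_pos[of k] by (simp_all add: lp_norm_def I_def)
    \<comment> \<open>Keeping only the \<open>k\<close>-th term of \<open>H\<close> gives
      \<open>G k y \<le> 2 ^ k * H y\<close>; its \<open>p\<close>-th root costs at most
      \<open>2 ^ k\<close> because \<open>1 / p \<le> 1\<close>.\<close>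
    have le: "norm (F k y) \<le> ?N * 2 ^ k * norm (g y)" for y
    proof -
      have "norm (F k y) = (I k * G k y) powr (1 / p)"
        using I_pos[of k] p by (simp add: G_def powr_powr)
      also have "\<dots> \<le> (I k * (2 ^ k * H y)) powr (1 / p)"
      proof (intro powr_mono2 mult_left_mono)
        show "G k y \<le> 2 ^ k * H y" using H_ge[of k y] by (simp add: field_simps)
      qed (use p I_nonneg G_nonneg in auto)
      also have "\<dots> = ?N * (2 ^ k) powr (1 / p) * norm (g y)"
        using I_nonneg H_nonneg by (simp add: N norm_g powr_mult)
      also have "\<dots> \<le> ?N * 2 ^ k * norm (g y)"
        using N p powr_mono[of "1 / p" 1 "2 ^ k :: real"]
        by (intro mult_right_mono mult_left_mono) auto
      finally show ?thesis .
    qed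
    have "4 ^ k * ?N < (\<Sum>\<^sub>\<infinity>y. a y * norm (F k y))" by (rule F(2))
    also have "\<dots> \<le> (\<Sum>\<^sub>\<infinity>y. ?N * 2 ^ k * (a y * norm (g y)))"
    proof (rule infsum_mono)
      show "(\<lambda>y. a y * norm (F k y)) summable_on UNIV" by (rule pair[OF F(1)])
      show "(\<lambda>y. ?N * 2 ^ k * (a y * norm (g y))) summable_on UNIV"
        by (intro summable_on_cmult_right pair g_lp)
      show "a y * norm (F k y) \<le> ?N * 2 ^ k * (a y * norm (g y))" for y
        using mult_left_mono[OF le a] by (simp add: mult_ac)
    qed
    also have "\<dots> = ?N * 2 ^ k * T"
      unfolding T_def by (intro infsum_cmult_right pair g_lp)
    finally have "4 ^ k < 2 ^ k * T" using N(2) by (simp add: mult_ac)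
    moreover have "(4 :: real) ^ k = 2 ^ k * 2 ^ k" by (simp flip: power_mult_distrib)
    ultimately show ?thesis by simp
  qed
  moreover obtain n where "T < 2 ^ n" using real_arch_pow[of 2 T] by auto
  ultimately show False by (meson linorder_not_le)
qed

text \<open>Testing the uniform bound on unit masses gives \<open>a y \<le> M * u y\<close>;
  conversely this inequality yields a summable majorant.\<close>

lemma lp_pairing_iff_exponent_1:
  fixes a u :: "'a \<Rightarrow> real"
  assumes u: "weight u" and a: "\<And>y. a y \<ge> 0"
  shows "(\<forall>f :: 'a \<Rightarrow> complex. f \<in> lp 1 u \<longrightarrow> (\<lambda>y. a y * norm (f y)) summable_on UNIV) \<longleftrightarrow>
    bdd_above (range (\<lambda>y. a y * inverse (u y)))"
proof
  have u0: "u y > 0" for y using u by (simp add: weight_def)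
  {
    assume "\<forall>f :: 'a \<Rightarrow> complex. f \<in> lp 1 u \<longrightarrow> (\<lambda>y. a y * norm (f y)) summable_on UNIV"
    then obtain M where M: "\<And>f :: 'a \<Rightarrow> complex. f \<in> lp 1 u \<Longrightarrow>
        (\<Sum>\<^sub>\<infinity>y. a y * norm (f y)) \<le> M * lp_norm 1 u f"
      using lp_pairing_bounded[of 1 u a] u a by auto
    have "a y * inverse (u y) \<le> M" for y
    proof -
      let ?f = "indicator {y} :: 'a \<Rightarrow> complex"
      have eq1: "a z * norm (?f z) = (if z = y then a y else 0)" 
        and eq2: "norm (?f z) powr 1 * u z = (if z = y then u y else 0)" for z
        by (auto simp: indicator_def)
      have sums: "(\<Sum>\<^sub>\<infinity>z. if z = y then c else 0) = c" for c :: real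
        by (subst infsum_cong_neutral[where T = "{y}" and g = "\<lambda>_. c"]) auto
      have "?f \<in> lp 1 u"
        unfolding lp_iff eq2 by (rule finite_nonzero_values_imp_summable_on) simp
      from M[OF this] have "a y \<le> M * u y"
        unfolding lp_norm_def eq1 eq2 sums using u0[of y] by simp
      then show ?thesis using u0[of y] by (simp add: field_simps)
    qed
    then show "bdd_above (range (\<lambda>y. a y * inverse (u y)))" by (intro bdd_aboveI[of _ M]) auto
  }
  {
    assume "bdd_above (range (\<lambda>y. a y * inverse (u y)))"
    then obtain M where M: "\<And>y. a y * inverse (u y) \<le> M" by (auto simp: bdd_above_def)
    show "\<forall>f :: 'a \<Rightarrow> complex. f \<in> lp 1 u \<longrightarrow> (\<lambda>y. a y * norm (f y)) summable_on UNIV"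
    proof (intro allI impI)
      fix f :: "'a \<Rightarrow> complex" assume "f \<in> lp 1 u"
      then have "(\<lambda>y. M * (norm (f y) powr 1 * u y)) summable_on UNIV"
        unfolding lp_iff by (rule summable_on_cmult_right)
      then show "(\<lambda>y. a y * norm (f y)) summable_on UNIV"
      proof (rule summable_on_comparison_test)
        fix y
        have "a y \<le> M * u y" using M[of y] u0[of y] by (simp add: field_simps)
        then show "a y * norm (f y) \<le> M * (norm (f y) powr 1 * u y)"
          using mult_right_mono[of "a y" "M * u y" "norm (f y)"] by (simp add: mult_ac)
      qed (use a in auto)
    qed
  }
qed

text \<open>Necessity tests the uniform bound on the extremal functions of Hoelder's inequality, cut
  off to finite sets; sufficiency is Young's inequality.\<close>

lemma lp_pairing_iff_exponent_gt_1:
  fixes a u :: "'a \<Rightarrow> real"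
  assumes p: "p > 1" and u: "weight u" and a: "\<And>y. a y \<ge> 0"
  shows "(\<forall>f :: 'a \<Rightarrow> complex. f \<in> lp p u \<longrightarrow> (\<lambda>y. a y * norm (f y)) summable_on UNIV) \<longleftrightarrow>
    (\<lambda>y. u y powr (- conj_exponent p / p) * a y powr conj_exponent p) summable_on UNIV"
proof
  have u0: "u y > 0" for y using u by (simp add: weight_def)
  define r where "r = conj_exponent p"
  have r: "r > 1" "1 / p + 1 / r = 1" "(r - 1) * p = r"
    using p by (auto simp: r_def conj_exponent_def field_simps)
  define b where "b y = u y powr (- r / p) * a y powr r" for y
  have b_nonneg: "b y \<ge> 0" for y by (simp add: b_def)
  {
    assume "\<forall>f :: 'a \<Rightarrow> complex. f \<in> lp p u \<longrightarrow> (\<lambda>y. a y * norm (f y)) summable_on UNIV"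
    then obtain M where M: "M \<ge> 0" "\<And>f :: 'a \<Rightarrow> complex. f \<in> lp p u \<Longrightarrow>
        (\<Sum>\<^sub>\<infinity>y. a y * norm (f y)) \<le> M * lp_norm p u f"
      using lp_pairing_bounded[of p u a] p u a by auto
    have bound: "(\<Sum>y\<in>S. b y) \<le> M powr r" if S: "finite S" for S
    proof -
      \<comment> \<open>The equality case of Hoelder: on \<open>S\<close>, both
        \<open>a y * norm (f y)\<close> and \<open>norm (f y) powr p * u y\<close> equal
        \<open>b y\<close>.\<close>
      define f where "f y = complex_of_real (if y \<in> S then a y powr (r - 1) * u y powr (- r / p) else 0)" for y
      have nf: "norm (f y) = (if y \<in> S then a y powr (r - 1) * u y powr (- r / p) else 0)" for y
        by (simp add: f_def)
      have eq1: "a y * norm (f y) = (if y \<in> S then b y else 0)" for y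
        using a[of y] r by (auto simp: nf b_def powr_diff)
      have eq2: "norm (f y) powr p * u y = (if y \<in> S then b y else 0)" for y
      proof -
        have "(u y powr (- r / p)) powr p * u y = u y powr (- r + 1)"
          using u0[of y] p by (subst powr_add) (simp add: powr_powr)
        also have "- r + 1 = - r / p"
          using r p by (simp add: field_simps)
        finally have "(u y powr (- r / p)) powr p * u y = u y powr (- r / p)" .
        moreover have "(a y powr (r - 1)) powr p = a y powr r"
          using r by (simp add: powr_powr)
        ultimately show ?thesis
          using a[of y] p by (simp add: nf b_def powr_mult mult_ac)
      qed
      have sums: "(\<Sum>\<^sub>\<infinity>y. if y \<in> S then b y else 0) = (\<Sum>y\<in>S. b y)"
        using S by (subst infsum_cong_neutral[where T = S and g = b]) auto
      have "f \<in> lp p u"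
        unfolding lp_iff eq2 by (rule finite_nonzero_values_imp_summable_on) (simp add: S)
      from M(2)[OF this] have le: "(\<Sum>y\<in>S. b y) \<le> M * (\<Sum>y\<in>S. b y) powr (1 / p)"
        unfolding lp_norm_def eq1 eq2 sums .
      show ?thesis
      proof (cases "(\<Sum>y\<in>S. b y) = 0")
        case False
        then have pos: "(\<Sum>y\<in>S. b y) > 0"
          using sum_nonneg[of S b] b_nonneg by (metis order_le_less)
        \<comment> \<open>As \<open>1 / r + 1 / p = 1\<close>, the power \<open>1 / p\<close>
          cancels and the partial sum is bounded independently of \<open>S\<close>.\<close>
        have "(\<Sum>y\<in>S. b y) powr (1 / r) * (\<Sum>y\<in>S. b y) powr (1 / p) = (\<Sum>y\<in>S. b y)"
          using r(2) pos by (simp flip: powr_add add: add.commute)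
        then have "(\<Sum>y\<in>S. b y) powr (1 / r) * (\<Sum>y\<in>S. b y) powr (1 / p) \<le>
            M * (\<Sum>y\<in>S. b y) powr (1 / p)"
          using le by simp
        then have "(\<Sum>y\<in>S. b y) powr (1 / r) \<le> M"
          by (rule mult_right_le_imp_le) (use pos in simp)
        then have "((\<Sum>y\<in>S. b y) powr (1 / r)) powr r \<le> M powr r"
          using r by (intro powr_mono2) auto
        then show ?thesis using pos r by (simp add: powr_powr)
      qed simp
    qed
    have "b summable_on UNIV"
      by (rule nonneg_bounded_partial_sums_imp_summable_on[where C = "M powr r"])
        (auto intro!: b_nonneg eventually_finite_subsets_at_top_weakI bound)
    then show "(\<lambda>y. u y powr (- conj_exponent p / p) * a y powr conj_exponent p) summable_on UNIV"
      by (simp add: b_def[abs_def] r_def)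
  }
  {
    assume "(\<lambda>y. u y powr (- conj_exponent p / p) * a y powr conj_exponent p) summable_on UNIV"
    then have b: "b summable_on UNIV"
      by (simp add: b_def[abs_def] r_def)
    show "\<forall>f :: 'a \<Rightarrow> complex. f \<in> lp p u \<longrightarrow> (\<lambda>y. a y * norm (f y)) summable_on UNIV"
    proof (intro allI impI)
      fix f :: "'a \<Rightarrow> complex" assume "f \<in> lp p u"
      then have "(\<lambda>y. (1 / p) * (norm (f y) powr p * u y) + (1 / r) * b y) summable_on UNIV"
        using b unfolding lp_iff by (intro summable_on_add summable_on_cmult_right)
      then show "(\<lambda>y. a y * norm (f y)) summable_on UNIV"
      proof (rule summable_on_comparison_test)
        fix y
        \<comment> \<open>The weight is split so that the \<open>p\<close>-th power of the first
          factor is the summand of the norm of \<open>f\<close> and the \<open>r\<close>-th power of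
          the second is \<open>b y\<close>.\<close>
        have "a y * norm (f y) = (norm (f y) * u y powr (1 / p)) * (a y * u y powr (- 1 / p))"
          using u0[of y] by (simp add: powr_minus field_simps)
        also have "\<dots> \<le> (norm (f y) * u y powr (1 / p)) powr p / p + (a y * u y powr (- 1 / p)) powr r / r"
          using p r a by (intro Youngs_inequality) auto
        also have "\<dots> = (1 / p) * (norm (f y) powr p * u y) + (1 / r) * b y"
          using p r a u0[of y] by (simp add: powr_mult powr_powr b_def)
        finally show "a y * norm (f y) \<le> (1 / p) * (norm (f y) powr p * u y) + (1 / r) * b y" .
      qed (use a in auto)
    qed
  }
qed

section \<open>The heat semigroup\<close>

lemma lp_norm_nonneg: "lp_norm p v g \<ge> 0"
  by (simp add: lp_norm_def)

text \<open>Where \<open>norm (g x) > s\<close>, the weight \<open>v x\<close> is at most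
  \<open>s powr (- p) * (norm (g x) powr p * v x)\<close>, and this is summed over that set.\<close>

lemma weak_lp_Chebyshev:
  fixes g :: "'a \<Rightarrow> real"
  assumes p: "p \<ge> 1" and v: "weight v" and g: "g \<in> lp p v"
  shows "g \<in> weak_lp p v" "weak_lp_norm p v g \<le> lp_norm p v g"
proof -
  have v0: "v x > 0" for x using v by (simp add: weight_def)
  have sg: "(\<lambda>x. norm (g x) powr p * v x) summable_on A" for A
    using g unfolding lp_iff by (rule summable_on_subset_banach) simp
  have le: "v x \<le> s powr (- p) * (norm (g x) powr p * v x)" if "s > 0" "norm (g x) > s" for s x
  proof -
    have "s powr p \<le> norm (g x) powr p"
      using that p by (intro powr_mono2) auto
    then have "1 \<le> s powr (- p) * norm (g x) powr p"
      using that(1) by (simp add: powr_minus field_simps)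
    then show ?thesis
      using mult_right_mono[of 1 "s powr (- p) * norm (g x) powr p" "v x"] v0[of x]
      by (simp add: mult_ac)
  qed
  have sv: "v summable_on {x. norm (g x) > s}" if "s > 0" for s
    by (rule summable_on_comparison_test[OF summable_on_cmult_right[OF sg, of "s powr (- p)"]])
      (use le[OF that] v0 in \<open>auto intro: less_imp_le\<close>)
  have bound: "s * infsum v {x. norm (g x) > s} powr (1 / p) \<le> lp_norm p v g" if "s > 0" for s
  proof -
    let ?I = "\<Sum>\<^sub>\<infinity>x. norm (g x) powr p * v x"
    have I: "?I \<ge> 0" using v0 by (intro infsum_nonneg mult_nonneg_nonneg) (auto intro: less_imp_le)
    have "infsum v {x. norm (g x) > s} \<le> (\<Sum>\<^sub>\<infinity>x\<in>{x. norm (g x) > s}. s powr (- p) * (norm (g x) powr p * v x))"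
      using le[OF that] by (intro infsum_mono sv that summable_on_cmult_right sg) auto
    also have "\<dots> = s powr (- p) * (\<Sum>\<^sub>\<infinity>x\<in>{x. norm (g x) > s}. norm (g x) powr p * v x)"
      by (intro infsum_cmult_right sg)
    also have "\<dots> \<le> s powr (- p) * ?I"
      by (intro mult_left_mono infsum_mono2 sg mult_nonneg_nonneg less_imp_le[OF v0]) auto
    finally have "infsum v {x. norm (g x) > s} powr (1 / p) \<le> (s powr (- p) * ?I) powr (1 / p)"
      using p v0 by (intro powr_mono2 infsum_nonneg) (auto intro: less_imp_le)
    also have "\<dots> = (s powr (- p)) powr (1 / p) * lp_norm p v g"
      using I by (simp add: lp_norm_def powr_mult)
    also have "(s powr (- p)) powr (1 / p) = 1 / s"
      using that p by (subst powr_powr) (simp add: powr_minus_divide)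
    finally show ?thesis using that by (simp add: field_simps)
  qed
  show "g \<in> weak_lp p v"
    unfolding weak_lp_def using sv bound by (auto intro!: bdd_aboveI[of _ "lp_norm p v g"])
  show "weak_lp_norm p v g \<le> lp_norm p v g"
    unfolding weak_lp_norm_def using bound by (intro cSUP_least) auto
qed

section \<open>Convergence and continuity in time of the kernel series\<close>

context tree
begin

text \<open>Since the kernel is nonnegative, absolute convergence is the pairing condition of the
  duality lemmas with \<open>a = kernel t x\<close>.\<close>

lemma heat_converges_iff:
  assumes "t \<ge> 0"
  shows "heat_converges q adj t f x \<longleftrightarrow> (\<lambda>y. kernel t x y * norm (f y)) summable_on UNIV"
  using kernel_nonneg[OF assms] by (simp add: heat_converges_def heat_kernel_gdist norm_mult)

lemma heat_converges_mono_time: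
  assumes "0 \<le> s" "s \<le> t" "heat_converges q adj t f x"
  shows "heat_converges q adj s f x"
proof -
  have "(\<lambda>y. exp t * (kernel t x y * norm (f y))) summable_on UNIV"
    using assms by (intro summable_on_cmult_right) (simp add: heat_converges_iff)
  then have "(\<lambda>y. kernel s x y * norm (f y)) summable_on UNIV"
  proof (rule summable_on_comparison_test)
    show "kernel s x y * norm (f y) \<le> exp t * (kernel t x y * norm (f y))" for y
      using mult_right_mono[OF kernel_mono_time[OF assms(1,2)] norm_ge_zero] by (simp add: mult.assoc)
  qed (use assms kernel_nonneg in auto)
  then show ?thesis using assms by (simp add: heat_converges_iff)
qed

lemma heat_converges_change_vertex:
  assumes "0 < s" "s < t" "heat_converges q adj t f x"
  shows "heat_converges q adj s f z"
proof -
  obtain C where C: "C \<ge> 0" "\<And>y. kernel s z y \<le> C * kernel t x y"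
    using kernel_change_vertex[OF assms(1,2)] by blast
  have "(\<lambda>y. C * (kernel t x y * norm (f y))) summable_on UNIV"
    using assms by (intro summable_on_cmult_right) (simp add: heat_converges_iff)
  then have "(\<lambda>y. kernel s z y * norm (f y)) summable_on UNIV"
  proof (rule summable_on_comparison_test)
    show "kernel s z y * norm (f y) \<le> C * (kernel t x y * norm (f y))" for y
      using mult_right_mono[OF C(2) norm_ge_zero] by (simp add: mult.assoc)
  qed (use assms kernel_nonneg in auto)
  then show ?thesis using assms by (simp add: heat_converges_iff)
qed

text \<open>Turns the limit as time tends to 0 into continuity on a closed interval.\<close>

lemma heat_0: "heat q adj 0 f x = f x"
proof -
  have "(\<lambda>y. complex_of_real (kernel 0 x y) * f y) = (\<lambda>y. if y = x then f x else 0)"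
    by (auto simp: kernel_0)
  moreover have "(\<Sum>\<^sub>\<infinity>y. if y = x then f x else 0) = f x"
    by (subst infsum_cong_neutral[where T = "{x}" and g = "\<lambda>_. f x"]) auto
  ultimately show ?thesis by (simp add: heat_def heat_kernel_gdist)
qed

text \<open>Weierstrass M-test: the summands at time \<open>R\<close>, multiplied by
  \<open>exp R\<close>, dominate those at all times in \<open>{0..R}\<close>.\<close>

lemma continuous_on_heat:
  assumes "R > 0" "heat_converges q adj R f x"
  shows "continuous_on {0..R} (\<lambda>t. heat q adj t f x)"
proof -
  have "uniform_limit {0..R} (\<lambda>Y t. \<Sum>y\<in>Y. complex_of_real (kernel t x y) * f y)
      (\<lambda>t. \<Sum>\<^sub>\<infinity>y. complex_of_real (kernel t x y) * f y) (finite_subsets_at_top UNIV)"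
  proof (rule Weierstrass_m_test_general)
    show "(\<lambda>y. exp R * (kernel R x y * norm (f y))) summable_on UNIV"
      using assms by (intro summable_on_cmult_right) (simp add: heat_converges_iff)
    fix y t assume "t \<in> {0..R}"
    then show "norm (complex_of_real (kernel t x y) * f y) \<le> exp R * (kernel R x y * norm (f y))"
      using mult_right_mono[OF kernel_mono_time[of t R x y] norm_ge_zero[of "f y"]] kernel_nonneg[of t x y]
      by (simp add: norm_mult mult_ac)
  qed
  then have "continuous_on {0..R} (\<lambda>t. \<Sum>\<^sub>\<infinity>y. complex_of_real (kernel t x y) * f y)"
    by (rule uniform_limit_theorem[rotated])
      (auto intro!: always_eventually continuous_intros continuous_on_kernel)
  then show ?thesis by (simp add: heat_def heat_kernel_gdist)
qed

lemma heat_tendsto_interior: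
  assumes "0 < s" "s < R" "heat_converges q adj R f x"
  shows "heat_tendsto q adj f x (heat q adj s f x) (at s)"
  unfolding heat_tendsto_def
proof
  have "\<forall>\<^sub>F t in at s. t \<in> {0<..<R}"
    using assms by (intro eventually_at_in_open') auto
  then show "\<forall>\<^sub>F t in at s. heat_converges q adj t f x"
    by eventually_elim (use assms in \<open>auto intro: heat_converges_mono_time[of _ R]\<close>)
  have "continuous_on {0<..<R} (\<lambda>t. heat q adj t f x)"
    using assms by (intro continuous_on_subset[OF continuous_on_heat[of R f x]]) auto
  then show "((\<lambda>t. heat q adj t f x) \<longlongrightarrow> heat q adj s f x) (at s)"
    using assms by (auto simp: continuous_on_eq_continuous_at isCont_def)
qed

lemma heat_tendsto_0:
  assumes "0 < R" "heat_converges q adj R f x"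
  shows "heat_tendsto q adj f x (f x) (at_right 0)"
  unfolding heat_tendsto_def
proof
  have "\<forall>\<^sub>F t in at_right 0. t \<in> {0<..<R}"
    using assms by (intro eventually_at_right_real)
  then show "\<forall>\<^sub>F t in at_right 0. heat_converges q adj t f x"
    by eventually_elim (use assms in \<open>auto intro: heat_converges_mono_time[of _ R]\<close>)
  have "((\<lambda>t. heat q adj t f x) \<longlongrightarrow> heat q adj 0 f x) (at 0 within {0..R})"
    using continuous_on_heat[OF assms] assms by (auto simp: continuous_on_def)
  then show "((\<lambda>t. heat q adj t f x) \<longlongrightarrow> f x) (at_right 0)"
    using assms by (simp add: heat_0 at_within_Icc_at_right)
qed

text \<open>The limit supplies a time \<open>t > R / 2\<close> of convergence, which depends on
  \<open>f\<close> and \<open>x\<close>. The fixed time \<open>R / 4\<close> lies below all of these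
  and so serves every \<open>f\<close> and every vertex.\<close>

lemma heat_tendsto_imp_heat_converges:
  assumes "R > 0" and lim: "heat_tendsto q adj f x l (at R)"
  shows "heat_converges q adj (R / 4) f z"
proof -
  have "\<forall>\<^sub>F t in at R. t \<in> {R / 2<..}"
    using assms by (intro eventually_at_in_open') auto
  moreover have "\<forall>\<^sub>F t in at R. heat_converges q adj t f x"
    using lim by (simp add: heat_tendsto_def)
  ultimately have "\<forall>\<^sub>F t in at R. t \<in> {R / 2<..} \<and> heat_converges q adj t f x"
    by (rule eventually_conj)
  then obtain t where "R / 2 < t" "heat_converges q adj t f x"
    using eventually_happens'[OF at_neq_bot] by fastforce
  then show ?thesis
    using assms by (intro heat_converges_change_vertex[of "R / 4" t f x]) auto
qed

text \<open>The majorant at time \<open>R\<close> controls all earlier times at once, so the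
  supremum at \<open>x\<close> is at most \<open>N x\<close> times the norm of \<open>f\<close>. The
  weight only has to make these pointwise bounds \<open>p\<close>-summable.\<close>

lemma heat_max_bounded_strong_if_converges:
  assumes p: "p \<ge> 1" and u: "weight u" and R: "R > 0"
    and conv: "\<And>f x. f \<in> lp p u \<Longrightarrow> heat_converges q adj R f x"
  shows "\<exists>v. weight v \<and> heat_max_bounded_strong q adj R p u v"
proof -
  have "\<exists>M\<ge>0. \<forall>f :: 'a \<Rightarrow> complex. f \<in> lp p u \<longrightarrow>
      (\<Sum>\<^sub>\<infinity>y. kernel R x y * norm (f y)) \<le> M * lp_norm p u f" for x
    using conv R by (intro lp_pairing_bounded p u kernel_nonneg) (auto simp: heat_converges_iff)
  then obtain M where M: "\<And>x. M x \<ge> 0" "\<And>x f. f \<in> lp p u \<Longrightarrow>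
      (\<Sum>\<^sub>\<infinity>y. kernel R x y * norm (f y :: complex)) \<le> M x * lp_norm p u f"
    by metis
  define N where "N x = exp R * M x" for x
  have N: "N x \<ge> 0" for x using M by (simp add: N_def)
  have heat_le: "norm (heat q adj t f x) \<le> N x * lp_norm p u f"
    if "f \<in> lp p u" "t \<in> {0<..<R}" for f x t
  proof -
    have sm: "(\<lambda>y. kernel r x y * norm (f y)) summable_on UNIV" if "0 \<le> r" "r \<le> R" for r
      using heat_converges_mono_time[of r R f x] conv[OF \<open>f \<in> lp p u\<close>] that
      by (simp add: heat_converges_iff)
    have norm_eq: "norm (complex_of_real (kernel t x y) * f y) = kernel t x y * norm (f y)" for y
      using kernel_nonneg[of t x y] that by (simp add: norm_mult)
    have "norm (heat q adj t f x) \<le> (\<Sum>\<^sub>\<infinity>y. kernel t x y * norm (f y))"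
      unfolding heat_def heat_kernel_gdist norm_eq[symmetric]
      by (rule norm_infsum_bound) (use sm[of t] that in \<open>simp add: norm_eq\<close>)
    also have "\<dots> \<le> (\<Sum>\<^sub>\<infinity>y. exp R * (kernel R x y * norm (f y)))"
    proof (intro infsum_mono sm summable_on_cmult_right)
      show "kernel t x y * norm (f y) \<le> exp R * (kernel R x y * norm (f y))" for y
        using mult_right_mono[OF kernel_mono_time[of t R x y] norm_ge_zero[of "f y"]] that
        by (simp add: mult.assoc)
    qed (use that R in auto)
    also have "\<dots> = exp R * (\<Sum>\<^sub>\<infinity>y. kernel R x y * norm (f y))"
      using R by (intro infsum_cmult_right sm) auto
    also have "\<dots> \<le> N x * lp_norm p u f"
      using M(2)[OF that(1), of x] by (simp add: N_def mult.assoc)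
    finally show ?thesis .
  qed
  obtain e :: "'a \<Rightarrow> nat" where e: "inj e"
    using countable_vertices by (auto simp: countable_def)
  \<comment> \<open>The denominator absorbs \<open>N x powr p\<close>, and the numerator is summable
    because \<open>e\<close> numbers the vertices injectively.\<close>
  define v where "v x = (1 / 2) ^ e x / (1 + N x powr p)" for x
  have den: "1 + N x powr p > 0" for x by (simp add: add_pos_nonneg)
  have v: "weight v" using den by (simp add: weight_def v_def)
  have geom: "(\<lambda>x. (1 / 2 :: real) ^ e x) summable_on UNIV"
  proof -
    have "(\<lambda>n. (1 / 2 :: real) ^ n) summable_on range e"
      by (rule summable_on_subset_banach[of _ UNIV]) (auto intro!: norm_summable_imp_summable_on)
    then show ?thesis using e by (simp add: summable_on_reindex o_def)
  qed
  define K where "K = (\<Sum>\<^sub>\<infinity>x. (1 / 2 :: real) ^ e x)"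
  have bound: "(\<forall>x. heat_max_finite q adj R f x) \<and> heat_max q adj R f \<in> lp p v \<and>
      lp_norm p v (heat_max q adj R f) \<le> K powr (1 / p) * lp_norm p u f" if f: "f \<in> lp p u" for f
  proof -
    let ?L = "lp_norm p u f"
    have L: "?L \<ge> 0" by (rule lp_norm_nonneg)
    have finite: "heat_max_finite q adj R f x" for x
      unfolding heat_max_finite_def
    proof
      show "\<forall>t\<in>{0<..<R}. heat_converges q adj t f x"
        using conv[OF f] by (auto intro: heat_converges_mono_time[of _ R])
      show "bdd_above ((\<lambda>t. norm (heat q adj t f x)) ` {0<..<R})"
        using heat_le[OF f] by (auto intro!: bdd_aboveI[of _ "N x * ?L"])
    qed
    have max_le: "heat_max q adj R f x \<le> N x * ?L" for x
      unfolding heat_max_def using heat_le[OF f] R by (intro cSUP_least) auto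
    \<comment> \<open>Any time in the interval would do here; \<open>R / 2\<close> shows that the
      supremum is taken over a nonempty set of nonnegative numbers.\<close>
    have max_nonneg: "heat_max q adj R f x \<ge> 0" for x
    proof -
      have "0 \<le> norm (heat q adj (R / 2) f x)" by simp
      also have "\<dots> \<le> heat_max q adj R f x"
        using finite[of x] R unfolding heat_max_def heat_max_finite_def by (intro cSUP_upper) auto
      finally show ?thesis .
    qed
    have le: "norm (heat_max q adj R f x) powr p * v x \<le> ?L powr p * (1 / 2) ^ e x" for x
    proof -
      have "norm (heat_max q adj R f x) powr p \<le> (N x * ?L) powr p"
        using max_le[of x] max_nonneg[of x] p by (intro powr_mono2) auto
      also have "\<dots> \<le> ?L powr p * (1 + N x powr p)"
        using N L by (simp add: powr_mult algebra_simps)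
      finally have "norm (heat_max q adj R f x) powr p * v x \<le> (?L powr p * (1 + N x powr p)) * v x"
        using v by (intro mult_right_mono) (auto simp: weight_def intro: less_imp_le)
      also have "\<dots> = ?L powr p * (1 / 2) ^ e x"
        using den[of x] by (simp add: v_def)
      finally show ?thesis .
    qed
    have v_nonneg: "0 \<le> norm (heat_max q adj R f x) powr p * v x" for x
      using v by (intro mult_nonneg_nonneg) (auto simp: weight_def intro: less_imp_le)
    have lp: "(\<lambda>x. norm (heat_max q adj R f x) powr p * v x) summable_on UNIV"
      by (rule summable_on_comparison_test[OF summable_on_cmult_right[OF geom] le v_nonneg])
    have "(\<Sum>\<^sub>\<infinity>x. norm (heat_max q adj R f x) powr p * v x) \<le> (\<Sum>\<^sub>\<infinity>x. ?L powr p * (1 / 2) ^ e x)"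
      by (intro infsum_mono lp summable_on_cmult_right geom le)
    also have "\<dots> = ?L powr p * K"
      unfolding K_def by (intro infsum_cmult_right geom)
    finally have "lp_norm p v (heat_max q adj R f) \<le> (?L powr p * K) powr (1 / p)"
      unfolding lp_norm_def[of p v] using p v_nonneg by (intro powr_mono2 infsum_nonneg) auto
    also have "\<dots> = K powr (1 / p) * ?L"
      using L p by (simp add: powr_mult powr_powr K_def infsum_nonneg)
    finally show ?thesis using finite lp by (simp add: lp_iff)
  qed
  then have "heat_max_bounded_strong q adj R p u v"
    unfolding heat_max_bounded_strong_def by blast
  then show ?thesis using v by blast
qed

end

section \<open>Equivalence of the conditions and the limit at time 0\<close>

theorem theorem1p3:
  fixes adj :: "'a \<Rightarrow> 'a \<Rightarrow> bool" and q :: nat and p :: real and u :: "'a \<Rightarrow> real"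
  assumes "1 \<le> p" and "q \<ge> 1" and "homogeneous_tree q adj" and "weight u"
  shows
    "let A = (\<exists>R>0. \<exists>v. weight v \<and> heat_max_bounded_strong q adj R p u v);
         B = (\<exists>R>0. \<exists>v. weight v \<and> heat_max_bounded_weak q adj R p u v);
         C = (\<exists>R1>0. \<forall>f\<in>lp p u. \<forall>x. \<exists>l. heat_tendsto q adj f x l (at R1));
         D = (\<exists>R1>0. \<forall>f\<in>lp p u. \<exists>x. \<exists>l. heat_tendsto q adj f x l (at R1));
         E = (\<exists>R>0. \<forall>x. \<forall>f\<in>lp p u. heat_max_finite q adj R f x);
         F = (\<exists>R>0. \<forall>x. \<forall>f\<in>lp p u. heat_converges q adj R f x);
         G = (\<exists>R>0. \<forall>x.
                (1 < p \<longrightarrow>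
                  (\<lambda>y. u y powr (- conj_exponent p / p) *
                       heat_kernel q adj R (gdist adj x y) powr conj_exponent p) summable_on UNIV) \<and>
                (p = 1 \<longrightarrow>
                  bdd_above (range (\<lambda>y. heat_kernel q adj R (gdist adj x y) * inverse (u y)))))
     in (A \<longleftrightarrow> B) \<and> (B \<longleftrightarrow> C) \<and> (C \<longleftrightarrow> D) \<and> (D \<longleftrightarrow> E) \<and> (E \<longleftrightarrow> F) \<and> (F \<longleftrightarrow> G) \<and>
        (A \<or> B \<or> C \<or> D \<or> E \<or> F \<or> G \<longrightarrow>
          (\<forall>f\<in>lp p u. \<forall>x. heat_tendsto q adj f x (f x) (at_right 0)))"
proof -
  interpret tree adj q using assms(2,3) by unfold_locales
  define A where "A \<longleftrightarrow> (\<exists>R>0. \<exists>v. weight v \<and> heat_max_bounded_strong q adj R p u v)"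
  define B where "B \<longleftrightarrow> (\<exists>R>0. \<exists>v. weight v \<and> heat_max_bounded_weak q adj R p u v)"
  define C where "C \<longleftrightarrow> (\<exists>R1>0. \<forall>f\<in>lp p u. \<forall>x. \<exists>l. heat_tendsto q adj f x l (at R1))"
  define D where "D \<longleftrightarrow> (\<exists>R1>0. \<forall>f\<in>lp p u. \<exists>x. \<exists>l. heat_tendsto q adj f x l (at R1))"
  define E where "E \<longleftrightarrow> (\<exists>R>0. \<forall>x. \<forall>f\<in>lp p u. heat_max_finite q adj R f x)"
  define F where "F \<longleftrightarrow> (\<exists>R>0. \<forall>x. \<forall>f\<in>lp p u. heat_converges q adj R f x)"
  define G where "G \<longleftrightarrow> (\<exists>R>0. \<forall>x.
      (1 < p \<longrightarrow>
        (\<lambda>y. u y powr (- conj_exponent p / p) *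
             heat_kernel q adj R (gdist adj x y) powr conj_exponent p) summable_on UNIV) \<and>
      (p = 1 \<longrightarrow>
        bdd_above (range (\<lambda>y. heat_kernel q adj R (gdist adj x y) * inverse (u y)))))"
  \<comment> \<open>The implications form two cycles through \<open>F\<close>, namely
    \<open>F\<close>, \<open>A\<close>, \<open>B\<close>, \<open>E\<close>, \<open>F\<close> and
    \<open>F\<close>, \<open>C\<close>, \<open>D\<close>, \<open>F\<close>, besides the equivalence
    with \<open>G\<close>.\<close>
  have "F \<longleftrightarrow> G"
  proof -
    \<comment> \<open>Duality applied to \<open>kernel R x\<close>, separately for each vertex, so
      \<open>F\<close> and \<open>G\<close> hold with the same \<open>R\<close>.\<close>
    have key: "(\<forall>f\<in>lp p u. heat_converges q adj R f x) \<longleftrightarrow>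
        (1 < p \<longrightarrow> (\<lambda>y. u y powr (- conj_exponent p / p) * kernel R x y powr conj_exponent p) summable_on UNIV) \<and>
        (p = 1 \<longrightarrow> bdd_above (range (\<lambda>y. kernel R x y * inverse (u y))))" if "R > 0" for R x
      using lp_pairing_iff_exponent_1[OF \<open>weight u\<close>, of "kernel R x"]
        lp_pairing_iff_exponent_gt_1[OF _ \<open>weight u\<close>, of p "kernel R x"] kernel_nonneg[of R x] that \<open>1 \<le> p\<close>
      by (cases "p = 1") (auto simp: heat_converges_iff)
    show ?thesis
      unfolding F_def G_def heat_kernel_gdist by (intro ex_cong1 conj_cong refl all_cong1 key)
  qed
  moreover have "F \<Longrightarrow> A"
    unfolding F_def A_def using heat_max_bounded_strong_if_converges[OF \<open>1 \<le> p\<close> \<open>weight u\<close>] by blast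
  moreover have "A \<Longrightarrow> B"
  proof -
    assume A
    then obtain R v K where R: "R > 0" "weight v" and K: "\<And>f. f \<in> lp p u \<Longrightarrow>
        (\<forall>x. heat_max_finite q adj R f x) \<and> heat_max q adj R f \<in> lp p v \<and>
        lp_norm p v (heat_max q adj R f) \<le> K * lp_norm p u f"
      unfolding A_def heat_max_bounded_strong_def by blast
    have "heat_max_bounded_weak q adj R p u v"
      unfolding heat_max_bounded_weak_def
      using K weak_lp_Chebyshev[OF \<open>1 \<le> p\<close> \<open>weight v\<close>] by (meson order_trans)
    then show B unfolding B_def using R by blast
  qed
  moreover have "B \<Longrightarrow> E"
    unfolding B_def E_def heat_max_bounded_weak_def by blast
  moreover have "E \<Longrightarrow> F"
  proof -
    assume E
    then obtain R where R: "R > 0" "\<And>x f. f \<in> lp p u \<Longrightarrow> heat_max_finite q adj R f x"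
      unfolding E_def by blast
    \<comment> \<open>Finiteness of the maximal function covers only times strictly below
      \<open>R\<close>, hence \<open>R / 2\<close>.\<close>
    then show F
      unfolding F_def heat_max_finite_def by (intro exI[of _ "R / 2"]) auto
  qed
  moreover have "F \<Longrightarrow> C"
  proof -
    assume F
    then obtain R where R: "R > 0" "\<And>x f. f \<in> lp p u \<Longrightarrow> heat_converges q adj R f x"
      unfolding F_def by blast
    \<comment> \<open>A two-sided limit needs convergence on both sides of its time, so an interior
      point of the interval up to \<open>R\<close> is taken.\<close>
    then show C
      unfolding C_def using heat_tendsto_interior[of "R / 2" R]
      by (intro exI[of _ "R / 2"]) (auto intro!: exI)
  qed
  moreover have "C \<Longrightarrow> D"
    unfolding C_def D_def by blast
  moreover have "D \<Longrightarrow> F"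
  proof -
    assume D
    then obtain R where R: "R > 0" "\<And>f. f \<in> lp p u \<Longrightarrow> \<exists>x l. heat_tendsto q adj f x l (at R)"
      unfolding D_def by blast
    then have "heat_converges q adj (R / 4) f z" if "f \<in> lp p u" for f z
      using that heat_tendsto_imp_heat_converges by blast
    then show F
      unfolding F_def using R(1) by (intro exI[of _ "R / 4"]) auto
  qed
  moreover have "F \<Longrightarrow> \<forall>f\<in>lp p u. \<forall>x. heat_tendsto q adj f x (f x) (at_right 0)"
    unfolding F_def using heat_tendsto_0 by blast
  ultimately show ?thesis
    unfolding Let_def A_def[symmetric] B_def[symmetric] C_def[symmetric] D_def[symmetric]
      E_def[symmetric] F_def[symmetric] G_def[symmetric] by blast
qed

end
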